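(* Let $\tau,\delta>0$ and let $p\notin X\subseteq\mathbb{R}^m$, where $p\in\mathbb{R}^m$ and $X$ is a finite set. Let $$d=\min_{x\in X}\|p-x\|>0.$$ Let $T:\mathbb{R}^m\to\mathbb{R}^k$ be a Gaussian random projection with $$k\ge\frac{\log\left(\frac{|X|}{\delta}\right)}{\log\left(\frac{d}{\tau}\right)}.$$ Then $$\mathrm{Prob}\Big(\min_{x\in X}\|T(p)-T(x)\|>\tau\Big)>1-\delta.$$
   Context: A Gaussian random projection $T:\mathbb{R}^m\to\mathbb{R}^k$ is the random linear map given by a $k\times m$ matrix whose entries are sampled independently from the normal distribution $\mathcal{N}(0,1)$. $\|\cdot\|$ is the Euclidean norm, and $|X|$ is the number of elements of $X$.
   Formalization: The formal theorem adds τ < d, takes X nonempty and k ≥ 1. For d = τ the quotient is undefined; for d < τ the claim fails, e.g. m = k = 1, |X| = 1, d = 0.01, τ = 1, δ = 1/2. Only trivial cases with d < τ (such as δ ≥ 1) are lost. *)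

theory Defs
  imports "HOL-Probability.Probability"
begin

definition gaussian_random_projection ::
    "'w measure \<Rightarrow> ('w \<Rightarrow> real ^ 'm::finite \<Rightarrow> real ^ 'k::finite) \<Rightarrow> bool" where
  "gaussian_random_projection M T \<longleftrightarrow>
     prob_space M \<and>
     (\<forall>w\<in>space M. linear (T w)) \<and>
     prob_space.indep_vars M (\<lambda>_. borel) (\<lambda>(i, j) w. matrix (T w) $ i $ j) (UNIV :: ('k \<times> 'm) set) \<and>
     (\<forall>i j. distributed M lborel (\<lambda>w. matrix (T w) $ i $ j) (\<lambda>x. ennreal (normal_density 0 1 x)))"

end

theory Submission
  imports Defs
begin

text \<open>
  For \<open>v \<noteq> 0\<close> the coordinates of \<open>T v\<close> are independent centred normal variables with
  standard deviation \<open>\<parallel>v\<parallel>\<close>, so their density is at most \<open>1 / (sqrt (2\<pi>) \<parallel>v\<parallel>)\<close>. Since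
  \<open>2 < sqrt (2\<pi>)\<close>, each coordinate lies in \<open>[-\<tau>, \<tau>]\<close> with probability less than \<open>\<tau> / \<parallel>v\<parallel>\<close>,
  and \<open>\<parallel>T v\<parallel> \<le> \<tau>\<close> has probability less than \<open>(\<tau> / \<parallel>v\<parallel>)^k\<close>. For \<open>v = p - x\<close> this is at most
  \<open>(\<tau> / d)^k \<le> \<delta> / |X|\<close>, and a union bound over \<open>x \<in> X\<close> finishes the proof.
\<close>

lemma normal_density_le:
  assumes "\<sigma> > 0"
  shows "normal_density \<mu> \<sigma> x \<le> 1 / (sqrt (2 * pi) * \<sigma>)"
proof -
  \<comment> \<open>The trailing 1 bounds the exponential factor.\<close>
  have "normal_density \<mu> \<sigma> x \<le> 1 / sqrt (2 * pi * \<sigma>\<^sup>2) * 1"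
    unfolding normal_density_def by (intro mult_left_mono) auto
  then show ?thesis
    using assms by (simp add: real_sqrt_mult)
qed

context prob_space
begin

lemma prob_normal_abs_le_less:
  assumes Y: "distributed M lborel Y (\<lambda>x. ennreal (normal_density \<mu> \<sigma> x))"
    and "\<sigma> > 0" "\<tau> > 0"
  shows "prob {w \<in> space M. \<bar>Y w\<bar> \<le> \<tau>} < \<tau> / \<sigma>"
proof -
  have "{w \<in> space M. \<bar>Y w\<bar> \<le> \<tau>} = Y -` {-\<tau>..\<tau>} \<inter> space M"
    by auto
  then have "emeasure M {w \<in> space M. \<bar>Y w\<bar> \<le> \<tau>}
      = (\<integral>\<^sup>+x. ennreal (normal_density \<mu> \<sigma> x) * indicator {-\<tau>..\<tau>} x \<partial>lborel)"
    using distributed_emeasure[OF Y, of "{-\<tau>..\<tau>}"] by simp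
  also have "\<dots> \<le> (\<integral>\<^sup>+x. ennreal (1 / (sqrt (2 * pi) * \<sigma>)) * indicator {-\<tau>..\<tau>} x \<partial>lborel)"
    using assms(2) by (intro nn_integral_mono mult_right_mono ennreal_leI normal_density_le) auto
  also have "\<dots> = ennreal (1 / (sqrt (2 * pi) * \<sigma>) * (2 * \<tau>))"
    using assms by (simp add: nn_integral_cmult_indicator ennreal_mult[symmetric])
  finally have "prob {w \<in> space M. \<bar>Y w\<bar> \<le> \<tau>} \<le> 1 / (sqrt (2 * pi) * \<sigma>) * (2 * \<tau>)"
    using assms by (simp add: emeasure_eq_measure ennreal_le_iff)
  also have "\<dots> < \<tau> / \<sigma>"
  proof -
    \<comment> \<open>Writing 2 as a square root reduces the claim to 4 < 2 pi. The strictness of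
      the final bound originates here.\<close>
    have "sqrt (2 * pi) > sqrt (2\<^sup>2)"
      using pi_gt3 by (intro real_sqrt_less_mono) (simp add: power2_eq_square)
    then have "2 < sqrt (2 * pi)"
      by simp
    then show ?thesis
      using assms by (simp add: field_simps)
  qed
  finally show ?thesis .
qed

lemma distributed_linear_combination_std_normal:
  assumes "finite I"
    and ind: "indep_vars (\<lambda>_. borel) Z I"
    and Z: "\<And>i. i \<in> I \<Longrightarrow> distributed M lborel (Z i) (\<lambda>x. ennreal (std_normal_density x))"
    and nz: "\<exists>i\<in>I. c i \<noteq> 0"
  shows "distributed M lborel (\<lambda>w. \<Sum>i\<in>I. c i * Z i w)
    (\<lambda>x. ennreal (normal_density 0 (L2_set c I) x))"
proof -
  \<comment> \<open>A term with zero coefficient is constant and has no density, whereas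
    \<open>sum_indep_normal\<close> requires positive standard deviations. Such terms are dropped
    and restored afterwards; the last hypothesis keeps \<open>J\<close> nonempty.\<close>
  define J where "J = {i \<in> I. c i \<noteq> 0}"
  have J: "finite J" "J \<noteq> {}" "J \<subseteq> I"
    using assms by (auto simp: J_def)
  have "indep_vars (\<lambda>_. borel) (\<lambda>i w. c i * Z i w) J"
    by (rule indep_vars_compose2[OF indep_vars_subset[OF ind J(3)], where Y = "\<lambda>i z. c i * z"]) simp
  moreover have "distributed M lborel (\<lambda>w. c i * Z i w)
      (\<lambda>x. ennreal (normal_density 0 \<bar>c i\<bar> x))" if "i \<in> J" for i
    using normal_density_affine[where X = "Z i" and \<mu> = 0 and \<sigma> = 1 and \<alpha> = "c i" and \<beta> = 0] Z that
    by (simp add: J_def)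
  ultimately have "distributed M lborel (\<lambda>w. \<Sum>i\<in>J. c i * Z i w)
      (\<lambda>x. ennreal (normal_density (\<Sum>i\<in>J. 0) (sqrt (\<Sum>i\<in>J. \<bar>c i\<bar>\<^sup>2)) x))"
    by (intro sum_indep_normal[OF J(1,2)]) (auto simp: J_def)
  moreover have "(\<Sum>i\<in>J. c i * Z i w) = (\<Sum>i\<in>I. c i * Z i w)" for w
    using \<open>finite I\<close> by (intro sum.mono_neutral_left) (auto simp: J_def)
  moreover have "(\<Sum>i\<in>J. (c i)\<^sup>2) = (\<Sum>i\<in>I. (c i)\<^sup>2)"
    using \<open>finite I\<close> by (intro sum.mono_neutral_left) (auto simp: J_def)
  ultimately show ?thesis
    by (simp add: L2_set_def)
qed

end

context
  fixes M :: "'w measure"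
    and T :: "'w \<Rightarrow> real ^ 'm::finite \<Rightarrow> real ^ 'k::finite"
  assumes T: "gaussian_random_projection M T"
begin

interpretation prob_space M
  using T by (simp add: gaussian_random_projection_def)

lemma gaussian_random_projection_nth:
  assumes "w \<in> space M"
  shows "T w v $ i = (\<Sum>j\<in>UNIV. v $ j * matrix (T w) $ i $ j)"
proof -
  have "linear (T w)"
    using T assms by (simp add: gaussian_random_projection_def)
  then have "T w v = matrix (T w) *v v"
    by (simp add: matrix_works linear_matrix_vector_mul_eq)
  then show ?thesis
    by (simp add: matrix_vector_mult_def mult.commute)
qed

text \<open>Measurability is known for the matrix entries; it passes to the norm because on
  \<open>space M\<close> the norm is a continuous expression in them.\<close>

lemma gaussian_random_projection_measurable:
  "(\<lambda>w. norm (T w v)) \<in> borel_measurable M"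
proof -
  have [measurable]: "(\<lambda>w. matrix (T w) $ i $ j) \<in> borel_measurable M" for i j
    using T distributed_measurable[of M lborel "\<lambda>w. matrix (T w) $ i $ j"]
    by (auto simp: gaussian_random_projection_def)
  have "(\<lambda>w. sqrt (\<Sum>i\<in>UNIV. (\<Sum>j\<in>UNIV. v $ j * matrix (T w) $ i $ j)\<^sup>2)) \<in> borel_measurable M"
    by measurable
  then show ?thesis
    by (rule measurable_cong[THEN iffD1, rotated])
       (simp add: norm_vec_def L2_set_def gaussian_random_projection_nth)
qed

lemma gaussian_random_projection_small_ball:
  assumes "v \<noteq> 0" "\<tau> > 0"
  shows "prob {w \<in> space M. norm (T w v) \<le> \<tau>} < (\<tau> / norm v) ^ CARD('k)"
proof -
  define Z where "Z = (\<lambda>(i, j) w. matrix (T w) $ i $ j)"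
  \<comment> \<open>\<open>K i\<close> indexes row i of the matrix; every row is weighted by the
    same vector \<open>v\<close>, so \<open>c\<close> ignores the row index.\<close>
  define K :: "'k \<Rightarrow> ('k \<times> 'm) set" where "K i = {i} \<times> UNIV" for i
  define c :: "'k \<times> 'm \<Rightarrow> real" where "c q = v $ snd q" for q
  define Y where "Y i w = (\<Sum>q\<in>K i. c q * Z q w)" for i w
  have ind: "indep_vars (\<lambda>_. borel) Z UNIV"
    and Z: "distributed M lborel (Z q) (\<lambda>x. ennreal (std_normal_density x))" for q
    using T by (auto simp: gaussian_random_projection_def Z_def split: prod.split)
  have sum_K: "(\<Sum>q\<in>K i. f q) = (\<Sum>j\<in>UNIV. f (i, j))" for i and f :: "'k \<times> 'm \<Rightarrow> real"
    using sum.cartesian_product[of "\<lambda>i j. f (i, j)" UNIV "{i}"] by (simp add: K_def)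
  have Y_eq: "T w v $ i = Y i w" if "w \<in> space M" for i w
    using that by (simp add: gaussian_random_projection_nth Y_def sum_K c_def Z_def)
  \<comment> \<open>Rows are disjoint blocks of an independent family, hence independent as tuples;
    each coordinate of the image is a measurable function of its own row.\<close>
  have "indep_vars (\<lambda>i. PiM (K i) (\<lambda>_. borel)) (\<lambda>i w. restrict (\<lambda>q. Z q w) (K i)) UNIV"
    by (rule indep_vars_restrict[OF ind]) (auto simp: disjoint_family_on_def K_def)
  then have "indep_vars (\<lambda>_. borel) (\<lambda>i w. \<Sum>q\<in>K i. c q * restrict (\<lambda>q. Z q w) (K i) q) UNIV"
    by (rule indep_vars_compose2[where Y = "\<lambda>i z. \<Sum>q\<in>K i. c q * z q"]) measurable
  then have indY: "indep_vars (\<lambda>_. borel) Y UNIV"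
    by (simp add: Y_def[abs_def])
  have "L2_set c (K i) = norm v" for i
    by (simp add: L2_set_def norm_vec_def sum_K c_def)
  moreover have "\<exists>q\<in>K i. c q \<noteq> 0" for i
    using \<open>v \<noteq> 0\<close> by (auto simp: vec_eq_iff K_def c_def)
  moreover have "finite (K i)" for i
    by (simp add: K_def)
  ultimately have Y: "distributed M lborel (Y i) (\<lambda>x. ennreal (normal_density 0 (norm v) x))" for i
    using distributed_linear_combination_std_normal[OF _ indep_vars_subset[OF ind], of "K i" c] Z
    by (simp add: Y_def[abs_def])
  have [measurable]: "random_variable borel (Y i)" for i
    using indY by (simp add: indep_vars_def)
  \<comment> \<open>The ball of radius \<tau> lies in the cube of side 2\<tau>, whose probability
    factors by independence.\<close>
  have "prob {w \<in> space M. norm (T w v) \<le> \<tau>} \<le> prob (\<Inter>i. Y i -` {-\<tau>..\<tau>} \<inter> space M)"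
  proof (rule finite_measure_mono)
    show "{w \<in> space M. norm (T w v) \<le> \<tau>} \<subseteq> (\<Inter>i. Y i -` {-\<tau>..\<tau>} \<inter> space M)"
    proof clarsimp
      fix w i assume w: "w \<in> space M" "norm (T w v) \<le> \<tau>"
      have "\<bar>T w v $ i\<bar> \<le> \<tau>"
        using component_le_norm_cart w(2) by (rule order_trans)
      then show "- \<tau> \<le> Y i w \<and> Y i w \<le> \<tau>"
        using Y_eq[OF w(1)] by (auto simp: abs_le_iff)
    qed
  qed measurable
  also have "\<dots> = (\<Prod>i\<in>UNIV. prob (Y i -` {-\<tau>..\<tau>} \<inter> space M))"
    by (rule indep_varsD_finite[OF indY]) auto
  also have "\<dots> = (\<Prod>i\<in>UNIV. prob {w \<in> space M. \<bar>Y i w\<bar> \<le> \<tau>})"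
    by (intro prod.cong refl arg_cong[where f = prob]) auto
  \<comment> \<open>Strictness survives the product since the factors are nonnegative and the type
    \<open>'k\<close> is nonempty.\<close>
  also have "\<dots> < (\<Prod>i\<in>(UNIV :: 'k set). \<tau> / norm v)"
    using assms prob_normal_abs_le_less[OF Y] by (intro prod_mono_strict) (auto intro: less_imp_le)
  finally show ?thesis
    by simp
qed

end

theorem proposition2p3:
  fixes M :: "'w measure"
    and T :: "'w \<Rightarrow> real ^ 'm::finite \<Rightarrow> real ^ 'k::finite"
    and X :: "(real ^ 'm) set"
    and p :: "real ^ 'm"
    and \<tau> \<delta> d :: real
  assumes "\<tau> > 0" and "\<delta> > 0"
    and "finite X" and "X \<noteq> {}" and "p \<notin> X"
    and "d = Min ((\<lambda>x. norm (p - x)) ` X)"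
    and "\<tau> < d"
    and "gaussian_random_projection M T"
    and "real CARD('k) \<ge> ln (real (card X) / \<delta>) / ln (d / \<tau>)"
  shows "measure M {w \<in> space M. Min ((\<lambda>x. norm (T w p - T w x)) ` X) > \<tau>} > 1 - \<delta>"
proof -
  note T = \<open>gaussian_random_projection M T\<close>
  interpret prob_space M
    using T by (simp add: gaussian_random_projection_def)
  define B where "B x = {w \<in> space M. norm (T w (p - x)) \<le> \<tau>}" for x
  have B[measurable]: "B x \<in> events" for x
    using gaussian_random_projection_measurable[OF T, of "p - x"] by (simp add: B_def)
  have card: "real (card X) > 0"
    using assms by (simp add: card_gt_0_iff)
  have pow: "(\<tau> / d) ^ CARD('k) \<le> \<delta> / real (card X)"
  proof -
    \<comment> \<open>Since \<tau> < d, the denominator \<open>ln (d / \<tau>)\<close> is positive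
      and can be multiplied out.\<close>
    have "ln (real (card X) / \<delta>) \<le> real CARD('k) * ln (d / \<tau>)"
      using assms(9) ln_gt_zero[of "d / \<tau>"] \<open>\<tau> > 0\<close> \<open>\<tau> < d\<close> by (simp add: pos_divide_le_eq)
    also have "\<dots> = ln ((d / \<tau>) ^ CARD('k))"
      using assms by (simp add: ln_realpow)
    finally have "real (card X) / \<delta> \<le> (d / \<tau>) ^ CARD('k)"
      using \<open>\<tau> > 0\<close> \<open>\<delta> > 0\<close> \<open>\<tau> < d\<close> card by (subst (asm) ln_le_cancel_iff) auto
    then show ?thesis
      using \<open>\<tau> > 0\<close> \<open>\<delta> > 0\<close> \<open>\<tau> < d\<close> card by (simp add: field_simps)
  qed
  have B_less: "prob (B x) < \<delta> / real (card X)" if "x \<in> X" for x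
  proof -
    have "d \<le> norm (p - x)"
      using assms that by simp
    \<comment> \<open>The nearest point of \<open>X\<close> is the worst case.\<close>
    then have "(\<tau> / norm (p - x)) ^ CARD('k) \<le> (\<tau> / d) ^ CARD('k)"
      using \<open>\<tau> > 0\<close> \<open>\<tau> < d\<close> by (intro power_mono frac_le) auto
    moreover have "p - x \<noteq> 0"
      using assms that by auto
    ultimately show ?thesis
      using gaussian_random_projection_small_ball[OF T, of "p - x" \<tau>] \<open>\<tau> > 0\<close> pow
      unfolding B_def by linarith
  qed
  have "prob (\<Union>x\<in>X. B x) \<le> (\<Sum>x\<in>X. prob (B x))"
    using assms by (intro finite_measure_subadditive_finite) auto
  \<comment> \<open>The sum is strictly smaller because \<open>X\<close> is nonempty.\<close>
  also have "\<dots> < (\<Sum>x\<in>X. \<delta> / real (card X))"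
    using assms B_less by (intro sum_strict_mono) auto
  also have "\<dots> = \<delta>"
    using card by simp
  finally have "prob (\<Union>x\<in>X. B x) < \<delta>" .
  moreover have "(\<Union>x\<in>X. B x) \<in> events"
    using assms by auto
  ultimately have "prob (space M - (\<Union>x\<in>X. B x)) > 1 - \<delta>"
    by (simp add: prob_compl)
  \<comment> \<open>By linearity \<open>B x\<close> is the event that the images of \<open>p\<close>
    and \<open>x\<close> are within \<tau>. As \<open>X\<close> is finite and nonempty, the minimum
    exceeds \<tau> exactly when no \<open>B x\<close> occurs.\<close>
  moreover have "T w p - T w x = T w (p - x)" if "w \<in> space M" for w x
    using T that by (simp add: gaussian_random_projection_def linear_diff)
  then have "{w \<in> space M. Min ((\<lambda>x. norm (T w p - T w x)) ` X) > \<tau>} = space M - (\<Union>x\<in>X. B x)"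
    using assms by (auto simp: B_def)
  ultimately show ?thesis
    by simp
qed

end
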